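(* Let $(\mathcal{S},d)$ be a compact metric space, let $\mu_0,\nu$ be Borel probability measures on $\mathcal{S}$, and let $\delta\ge0$. Let $\mathcal{W}(\mu,\nu)$ denote the order-1 Wasserstein distance between Borel probability measures on $\mathcal{S}$, i.e. the minimum of $\mathbb{E}_\pi d(X,Y)$ over all couplings $\pi$ of $X\sim\mu$ and $Y\sim\nu$. Then $$\min\{\mathcal{W}(\mu,\nu):\mu\text{ a Borel probability measure on }\mathcal{S},\ \mathcal{W}(\mu_0,\mu)\le\delta\}=\max\{\mathcal{W}(\mu_0,\nu)-\delta,\,0\}.$$ *)

theory Defs
  imports "HOL-Probability.Probability"
begin

definition borel_prob :: "'a::topological_space measure \<Rightarrow> bool" where
  "borel_prob \<mu> \<longleftrightarrow> prob_space \<mu> \<and> sets \<mu> = sets borel"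

text \<open>
  A coupling is identified with the joint law of the pair (X, Y), a measure on the product
  sigma-algebra. Without second countability the latter can be smaller than the Borel
  sigma-algebra of the product space; over a compact metric space the two coincide.
\<close>

definition couplings :: "'a measure \<Rightarrow> 'b measure \<Rightarrow> ('a \<times> 'b) measure set" where
  "couplings \<mu> \<nu> =
     {\<pi>. prob_space \<pi> \<and> sets \<pi> = sets (\<mu> \<Otimes>\<^sub>M \<nu>) \<and> distr \<pi> \<mu> fst = \<mu> \<and> distr \<pi> \<nu> snd = \<nu>}"

definition transport_cost :: "('a::metric_space \<times> 'a) measure \<Rightarrow> real" where
  "transport_cost \<pi> = (\<integral>z. dist (fst z) (snd z) \<partial>\<pi>)"

text \<open>
  The value is a genuine minimum, not an infimum. \<^const>\<open>Least\<close> is unspecified when no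
  minimum exists, which does not happen for Borel probability measures on a compact space.
\<close>

definition wasserstein :: "'a::metric_space measure \<Rightarrow> 'a measure \<Rightarrow> real" where
  "wasserstein \<mu> \<nu> = (LEAST c. c \<in> transport_cost ` couplings \<mu> \<nu>)"

definition is_minimum :: "real set \<Rightarrow> real \<Rightarrow> bool" where
  "is_minimum A m \<longleftrightarrow> m \<in> A \<and> (\<forall>a\<in>A. m \<le> a)"

end

(*
  The lower bound is the triangle inequality. The bound is attained by mixing: for an optimal pair
  (X, Y) and an independent Bernoulli(t) switch, the law of "Y if the switch is on, else X" costs
  at most t W from mu_0 and at most (1 - t) W from nu.

  Optimal couplings exist by weak compactness: a compact metric space has a Borel code into the
  reals whose inverse is uniformly continuous, so it inherits weak sequential compactness of
  probability measures from Helly's selection theorem on the line. The triangle inequality needs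
  no disintegration: two couplings with common marginal are glued along a partition into cells of
  diameter below epsilon, and epsilon tends to 0.
*)
theory Submission
  imports Defs
begin

text \<open>The type carries only a metric, so second countability, completeness, and agreement of
  the product and Borel sigma-algebras on pairs are all extracted from compactness. A continuous
  injection into the line need not exist (think of a circle), so the code is merely Borel:
  membership in the n-th set of a countable base is read as the n-th ternary digit. Using only the
  digits 0 and 1 in base 3 leaves gaps, as in the Cantor set, so close codes share their first
  digits. This makes the inverse uniformly continuous, and that is the direction that matters: a
  continuous function f on the space becomes F composed with the code, with F continuous on the
  line, so weak limits on the line can be tested against f although the code itself may jump.
  Rounding the same code to a grid gives the countable measurable partition used for gluing.
  Conditioning on a cell of positive mass is a division, where conditioning on a point would require
  a kernel. The space need not be geodesic, so the minimizer cannot be found by moving mass part of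
  the way; mixing laws replaces this and needs no intermediate points.\<close>

section \<open>A Borel code of the space into the reals\<close>

text \<open>Total boundedness gives a finite net at each scale 1/(m+1), and the balls around all the
  nets form the base. A point of a ball of radius below e/2 sees the whole ball within e.\<close>

lemma compact_countable_basis:
  assumes "compact (UNIV :: 'a::metric_space set)"
  obtains B :: "nat \<Rightarrow> 'a::metric_space set"
  where "\<And>n. open (B n)" "\<And>x U. open U \<Longrightarrow> x \<in> U \<Longrightarrow> \<exists>n. x \<in> B n \<and> B n \<subseteq> U"
proof -
  have "\<exists>k. finite k \<and> (UNIV :: 'a set) = (\<Union>x\<in>k. ball x (1 / real (Suc m)))" for m
  proof -
    have "(0::real) < 1 / real (Suc m)" by simp
    then obtain k where "finite k" "(UNIV :: 'a set) \<subseteq> (\<Union>x\<in>k. ball x (1 / real (Suc m)))"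
      using seq_compact_imp_totally_bounded[of "UNIV :: 'a set"] assms
      unfolding compact_eq_seq_compact_metric by blast
    then show ?thesis by blast
  qed
  then obtain k where k: "\<And>m. finite (k m)"
      "\<And>m. (UNIV :: 'a set) = (\<Union>x\<in>k m. ball x (1 / real (Suc m)))"
    by metis
  define \<B> where "\<B> = (\<Union>m. (\<lambda>x. ball x (1 / real (Suc m))) ` k m)"
  have "countable \<B>"
    unfolding \<B>_def using k(1) by (auto intro: countable_finite)
  moreover have "\<B> \<noteq> {}"
  proof
    assume "\<B> = {}"
    then have "k 0 = {}" unfolding \<B>_def by blast
    then show False using k(2)[of 0] by simp
  qed
  ultimately have rng: "range (from_nat_into \<B>) = \<B>"
    by (intro range_from_nat_into)
  show thesis
  proof
    show "open (from_nat_into \<B> n)" for n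
    proof -
      have "from_nat_into \<B> n \<in> \<B>" using rng by blast
      then show ?thesis unfolding \<B>_def by auto
    qed
    fix x :: 'a and U :: "'a set" assume "open U" "x \<in> U"
    then obtain e where e: "e > 0" "ball x e \<subseteq> U"
      by (meson open_contains_ball)
    have "0 < e / 2" using e by simp
    then obtain m where m: "1 / real (Suc m) < e / 2"
      by (rule nat_approx_posE)
    obtain y where y: "y \<in> k m" "x \<in> ball y (1 / real (Suc m))"
      using k(2)[of m] by blast
    have "ball y (1 / real (Suc m)) \<subseteq> ball x e"
    proof
      fix z assume "z \<in> ball y (1 / real (Suc m))"
      then show "z \<in> ball x e"
        using y(2) m dist_triangle[of x z y] by (simp add: dist_commute)
    qed
    moreover have "ball y (1 / real (Suc m)) \<in> \<B>"
      unfolding \<B>_def using y(1) by blast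
    then obtain n where "from_nat_into \<B> n = ball y (1 / real (Suc m))"
      using rng by (metis imageE)
    ultimately show "\<exists>n. x \<in> from_nat_into \<B> n \<and> from_nat_into \<B> n \<subseteq> U"
      using y(2) e(2) by (intro exI[of _ n]) simp
  qed
qed

lemma suminf_third_powers: "(\<Sum>j. 1 / 3 ^ (j + m) :: real) = 3 / 2 / 3 ^ m"
  "summable (\<lambda>j. 1 / 3 ^ (j + m) :: real)"
proof -
  have "(\<lambda>j. (1/3) ^ j * (1 / 3 ^ m) :: real) sums (1 / (1 - 1/3) * (1 / 3 ^ m))"
    by (intro sums_mult2 geometric_sums) auto
  moreover have "(\<lambda>j. (1/3) ^ j * (1 / 3 ^ m) :: real) = (\<lambda>j. 1 / 3 ^ (j + m))"
    by (simp add: power_add power_divide)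
  ultimately have "(\<lambda>j. 1 / 3 ^ (j + m) :: real) sums (3 / 2 / 3 ^ m)" by simp
  then show "(\<Sum>j. 1 / 3 ^ (j + m) :: real) = 3 / 2 / 3 ^ m"
    "summable (\<lambda>j. 1 / 3 ^ (j + m) :: real)"
    by (auto simp: sums_iff)
qed

text \<open>At the first disagreement \<open>l\<close> the difference is 3^-l, while the later
  digits can cancel at most the sum of 3^-j over j > l, which is half of that. In base 2 the tail
  could cancel the leading term completely.\<close>

lemma ternary_expansion_separates:
  fixes a b :: "nat \<Rightarrow> real"
  assumes a: "\<And>j. a j \<in> {0, 1}" and b: "\<And>j. b j \<in> {0, 1}" and ne: "a k \<noteq> b k"
  shows "1 / (2 * 3 ^ k) \<le> \<bar>(\<Sum>j. a j / 3 ^ j) - (\<Sum>j. b j / 3 ^ j)\<bar>"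
proof -
  define l where "l = (LEAST j. a j \<noteq> b j)"
  have l: "a l \<noteq> b l" "l \<le> k" "j < l \<Longrightarrow> a j = b j" for j
    unfolding l_def
    by (fact LeastI[of "\<lambda>j. a j \<noteq> b j", OF ne], fact Least_le[of "\<lambda>j. a j \<noteq> b j", OF ne],
        blast dest: not_less_Least)
  define c where "c j = (a j - b j) / 3 ^ j" for j
  have c_le: "\<bar>c j\<bar> \<le> 1 / 3 ^ j" for j
    using a[of j] b[of j] by (auto simp: c_def)
  have s01: "summable (\<lambda>j. u j / 3 ^ j)" if "\<And>j. u j \<in> {0, 1}" for u :: "nat \<Rightarrow> real"
  proof (rule summable_comparison_test[OF _ suminf_third_powers(2)[of 0]])
    have "norm (u n / 3 ^ n) \<le> 1 / 3 ^ (n + 0)" for n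
      using that[of n] by auto
    then show "\<exists>N. \<forall>n\<ge>N. norm (u n / 3 ^ n) \<le> 1 / 3 ^ (n + 0)" by blast
  qed
  have diff: "(\<Sum>j. a j / 3 ^ j) - (\<Sum>j. b j / 3 ^ j) = suminf c"
    unfolding c_def diff_divide_distrib by (rule suminf_diff[OF s01[OF a] s01[OF b]])
  have sc: "summable c"
    unfolding c_def diff_divide_distrib by (rule summable_diff[OF s01[OF a] s01[OF b]])
  \<comment> \<open>The terms below \<open>l\<close> vanish by minimality, leaving the leading term
    and a tail.\<close>
  have split: "suminf c = (\<Sum>j. c (j + Suc l)) + c l"
    using suminf_split_initial_segment[OF sc, of "Suc l"] l(3) by (simp add: c_def)
  have sm: "summable (\<lambda>j. \<bar>c (j + Suc l)\<bar>)"
    by (rule summable_comparison_test[OF _ suminf_third_powers(2)[of "Suc l"]])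
       (simp only: real_norm_def abs_abs c_le, simp)
  then have "\<bar>\<Sum>j. c (j + Suc l)\<bar> \<le> (\<Sum>j. \<bar>c (j + Suc l)\<bar>)"
    by (rule summable_rabs)
  also have "\<dots> \<le> (\<Sum>j. 1 / 3 ^ (j + Suc l))"
    by (rule suminf_le[OF c_le sm suminf_third_powers(2)])
  also have "\<dots> = 1 / (2 * 3 ^ l)"
    by (subst suminf_third_powers) simp
  finally have tail: "\<bar>\<Sum>j. c (j + Suc l)\<bar> \<le> 1 / (2 * 3 ^ l)" .
  have "\<bar>c l\<bar> = 1 / 3 ^ l"
    using a[of l] b[of l] l(1) by (auto simp: c_def)
  with tail split have "1 / 3 ^ l - 1 / (2 * 3 ^ l) \<le> \<bar>suminf c\<bar>" by linarith
  moreover have "1 / (2 * 3 ^ k) \<le> (1 / (2 * 3 ^ l) :: real)"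
    using l(2) by (intro divide_left_mono mult_left_mono power_increasing) auto
  moreover have "1 / 3 ^ l - 1 / (2 * 3 ^ l) = (1 / (2 * 3 ^ l) :: real)" by (simp add: field_simps)
  ultimately show ?thesis by (simp add: diff)
qed

text \<open>The last property is uniform continuity of the inverse, and contains injectivity. It
  comes from compactness: finitely many base sets of small diameter cover the space, so agreement on
  finitely many digits already places two points in a common small set.\<close>

lemma compact_metric_real_code:
  assumes comp: "compact (UNIV :: 'a::metric_space set)"
  obtains s :: "'a::metric_space \<Rightarrow> real"
  where "s \<in> borel_measurable borel" "\<And>z. s z \<in> {0..2}"
    "\<And>e. e > 0 \<Longrightarrow> \<exists>d>0. \<forall>z z'. \<bar>s z - s z'\<bar> < d \<longrightarrow> dist z z' < e"
proof -
  obtain B :: "nat \<Rightarrow> 'a set" where B: "\<And>n. open (B n)"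
      "\<And>x U. open U \<Longrightarrow> x \<in> U \<Longrightarrow> \<exists>n. x \<in> B n \<and> B n \<subseteq> U"
    using compact_countable_basis[OF comp] by metis
  define s where "s z = (\<Sum>j. indicator (B j) z / 3 ^ j :: real)" for z
  show thesis
  proof
    show "s \<in> borel_measurable borel"
    proof -
      have [measurable]: "B j \<in> sets borel" for j using B(1) by simp
      show ?thesis unfolding s_def[abs_def] by measurable
    qed
    show "s z \<in> {0..2}" for z
    proof -
      have sm: "summable (\<lambda>j. indicator (B j) z / 3 ^ j :: real)"
        by (rule summable_comparison_test[OF _ suminf_third_powers(2)[of 0]])
           (auto simp: indicator_def)
      have "s z \<le> (\<Sum>j. 1 / 3 ^ (j + 0))"
        unfolding s_def
        by (rule suminf_le[OF _ sm suminf_third_powers(2)]) (auto simp: indicator_def)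
      also have "\<dots> = 3 / 2" by (subst suminf_third_powers) simp
      finally have "s z \<le> 2" by simp
      moreover have "0 \<le> s z"
        unfolding s_def by (rule suminf_nonneg[OF sm]) auto
      ultimately show ?thesis by simp
    qed
    fix e :: real assume "e > 0"
    define I where "I = {n. \<forall>z\<in>B n. \<forall>z'\<in>B n. dist z z' < e}"
    have "UNIV \<subseteq> (\<Union>n\<in>I. B n)"
    proof
      fix x :: 'a
      obtain n where n: "x \<in> B n" "B n \<subseteq> ball x (e/2)"
        using B(2)[of "ball x (e/2)" x] \<open>e > 0\<close> by auto
      have "dist z z' < e" if "z \<in> B n" "z' \<in> B n" for z z'
      proof -
        have "dist x z < e/2" "dist x z' < e/2" using that n(2) by auto
        then show ?thesis using dist_triangle3[of z z' x] by linarith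
      qed
      then show "x \<in> (\<Union>n\<in>I. B n)" using n unfolding I_def by blast
    qed
    then obtain J where J: "J \<subseteq> I" "finite J" "UNIV \<subseteq> (\<Union>n\<in>J. B n)"
      using compactE_image[OF comp, of I B] B(1) by metis
    \<comment> \<open>The last digit that has to be compared; the radius 1/(2 * 3^N) below is the
      gap that a disagreement at any digit up to \<open>N\<close> would force.\<close>
    define N where "N = Max (insert 0 J)"
    have "dist z z' < e" if d: "\<bar>s z - s z'\<bar> < 1 / (2 * 3 ^ N)" for z z'
    proof -
      obtain k where k: "k \<in> J" "z \<in> B k" using J(3) by blast
      then have "k \<le> N" using J(2) by (simp add: N_def)
      then have "1 / (2 * 3 ^ N) \<le> (1 / (2 * 3 ^ k) :: real)"
        by (intro divide_left_mono mult_left_mono power_increasing) auto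
      then have "indicator (B k) z = (indicator (B k) z' :: real)"
        using ternary_expansion_separates[of "\<lambda>j. indicator (B j) z" "\<lambda>j. indicator (B j) z'" k] d
        unfolding s_def by (fastforce simp: indicator_def simp del: divide_le_eq_1)
      then have "z' \<in> B k" using k by (simp add: indicator_def split: if_splits)
      then show ?thesis using k J(1) unfolding I_def by blast
    qed
    then show "\<exists>d>0. \<forall>z z'. \<bar>s z - s z'\<bar> < d \<longrightarrow> dist z z' < e"
      by (intro exI[of _ "1 / (2 * 3 ^ N)"]) auto
  qed
qed

text \<open>A uniformly continuous map into a complete space extends to the closure of its domain;
  here the map is the inverse of \<open>s\<close>. The extension to the closure is needed because
  weak limits of laws on \<open>range s\<close> may charge limit points of it.\<close>

lemma real_code_inverse:
  fixes s :: "'a::metric_space \<Rightarrow> real"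
  assumes comp: "compact (UNIV :: 'a set)"
    and uni: "\<And>e. e > 0 \<Longrightarrow> \<exists>d>0. \<forall>z z'. \<bar>s z - s z'\<bar> < d \<longrightarrow> dist z z' < e"
  obtains g where "continuous_on (closure (range s)) g" "\<And>z. g (s z) = z"
proof -
  \<comment> \<open>The limit value is characterized by all codes near \<open>x\<close> rather than
    by one approximating sequence, so that both the left inverse property and continuity can be read
    off from it.\<close>
  have "\<exists>y. \<forall>e>0. \<exists>d>0. \<forall>z. \<bar>s z - x\<bar> < d \<longrightarrow> dist z y < e" if x: "x \<in> closure (range s)" for x
  proof -
    have "\<exists>t. (\<forall>n. t n \<in> range s) \<and> t \<longlonglongrightarrow> x"
      using x by (simp only: closure_sequential)
    then obtain t where t: "\<forall>n. t n \<in> range s" "t \<longlonglongrightarrow> x"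
      by (elim exE conjE)
    have "\<forall>n. \<exists>z. t n = s z" using t(1) by fast
    then obtain w where w: "\<And>n. t n = s (w n)"
      by metis
    have "Cauchy w"
    proof (rule metric_CauchyI)
      fix e :: real assume "e > 0"
      then obtain d where d: "d > 0" "\<And>z z'. \<bar>s z - s z'\<bar> < d \<Longrightarrow> dist z z' < e"
        using uni by metis
      have "Cauchy t" using t(2) by (rule LIMSEQ_imp_Cauchy)
      then obtain M where "\<forall>m\<ge>M. \<forall>n\<ge>M. dist (t m) (t n) < d"
        using d(1) metric_CauchyD by blast
      then show "\<exists>M. \<forall>m\<ge>M. \<forall>n\<ge>M. dist (w m) (w n) < e"
        using d(2) w by (metis dist_real_def)
    qed
    then obtain y where y: "w \<longlonglongrightarrow> y"
      using compact_imp_complete[OF comp] unfolding complete_def by blast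
    have "\<exists>d>0. \<forall>z. \<bar>s z - x\<bar> < d \<longrightarrow> dist z y < e" if "e > 0" for e
    proof -
      have "e / 2 > 0" using \<open>e > 0\<close> by simp
      then obtain d where d: "d > 0" "\<And>z z'. \<bar>s z - s z'\<bar> < d \<Longrightarrow> dist z z' < e / 2"
        using uni by metis
      have "dist z y < e" if z: "\<bar>s z - x\<bar> < d / 2" for z
      proof -
        have "\<forall>\<^sub>F n in sequentially. dist (t n) x < d / 2"
          using t(2) d(1) by (intro tendstoD) auto
        moreover have "\<forall>\<^sub>F n in sequentially. dist (w n) y < e / 2"
          using y \<open>e > 0\<close> by (intro tendstoD) auto
        ultimately have "\<forall>\<^sub>F n in sequentially. dist (t n) x < d / 2 \<and> dist (w n) y < e / 2"
          by (rule eventually_conj)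
        then obtain n where n: "dist (t n) x < d / 2" "dist (w n) y < e / 2"
          by (auto dest: eventually_happens)
        have "\<bar>s z - s (w n)\<bar> < d"
          using n(1) z unfolding w dist_real_def by linarith
        then show ?thesis
          using d(2)[of z "w n"] n(2) dist_triangle[of z y "w n"] by linarith
      qed
      then show ?thesis using d(1) by (intro exI[of _ "d / 2"]) auto
    qed
    then show ?thesis by blast
  qed
  then obtain g where g: "\<And>x e. x \<in> closure (range s) \<Longrightarrow> e > 0 \<Longrightarrow>
      \<exists>d>0. \<forall>z. \<bar>s z - x\<bar> < d \<longrightarrow> dist z (g x) < e"
    by metis
  show thesis
  proof
    show "g (s z) = z" for z
    proof (rule ccontr)
      assume "g (s z) \<noteq> z"
      then have "dist z (g (s z)) > 0" by simp
      moreover have "s z \<in> closure (range s)"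
        by (rule subsetD[OF closure_subset]) simp
      ultimately obtain d where "d > 0" "\<forall>z'. \<bar>s z' - s z\<bar> < d \<longrightarrow> dist z' (g (s z)) < dist z (g (s z))"
        using g by blast
      then show False by (metis abs_zero diff_self less_irrefl)
    qed
    show "continuous_on (closure (range s)) g"
      unfolding continuous_on_iff
    proof (intro ballI allI impI)
      fix x and e :: real assume x: "x \<in> closure (range s)" and "e > 0"
      then have e2: "e / 2 > 0" by simp
      obtain d where d: "d > 0" "\<And>z. \<bar>s z - x\<bar> < d \<Longrightarrow> dist z (g x) < e / 2"
        using g[OF x e2] by blast
      have "dist (g y) (g x) < e" if y: "y \<in> closure (range s)" and yx: "dist y x < d / 2" for y
      proof -
        obtain d' where d': "d' > 0" "\<And>z. \<bar>s z - y\<bar> < d' \<Longrightarrow> dist z (g y) < e / 2"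
          using g[OF y e2] by blast
        \<comment> \<open>A code close enough to \<open>y\<close> for both radii belongs to a point
          near \<open>g x\<close> and near \<open>g y\<close> at once.\<close>
        have "\<exists>t\<in>range s. dist t y < min d' (d / 2)"
        proof -
          have "0 < min d' (d / 2)" using d(1) d'(1) by simp
          then show ?thesis using y unfolding closure_approachable by blast
        qed
        then obtain z where z: "dist (s z) y < min d' (d / 2)" by blast
        have "dist z (g y) < e / 2" using z d'(2) by (simp add: dist_real_def)
        moreover have "dist z (g x) < e / 2"
          using z yx unfolding dist_real_def by (intro d(2)) linarith
        ultimately show ?thesis using dist_triangle3[of "g y" "g x" z] by linarith
      qed
      then show "\<exists>d>0. \<forall>x'\<in>closure (range s). dist x' x < d \<longrightarrow> dist (g x') (g x) < e"
        using d(1) by (intro exI[of _ "d / 2"]) auto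
    qed
  qed
qed

section \<open>Weak sequential compactness of probability measures\<close>

text \<open>The laws of \<open>s\<close> all live on [0, 2], hence are tight, and a subsequence
  converges weakly to some \<open>N'\<close> on the line. The work lies in returning:
  \<open>N'\<close> must be shown to sit on \<open>K\<close>, and each continuous test function must
  be rewritten as a bounded continuous function of the code.\<close>

lemma compact_prob_convergent_subseq:
  fixes M :: "nat \<Rightarrow> 'a::metric_space measure"
  assumes comp: "compact (UNIV :: 'a set)" and M: "\<And>n. borel_prob (M n)"
  obtains r N where "strict_mono (r :: nat \<Rightarrow> nat)" "borel_prob N"
    "\<And>f :: 'a \<Rightarrow> real. continuous_on UNIV f \<Longrightarrow>
       (\<lambda>n. \<integral>x. f x \<partial>M (r n)) \<longlonglongrightarrow> (\<integral>x. f x \<partial>N)"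
proof -
  obtain s :: "'a \<Rightarrow> real" where s[measurable]: "s \<in> borel_measurable borel"
    and s02: "\<And>z. s z \<in> {0..2}"
    and uni: "\<And>e. e > 0 \<Longrightarrow> \<exists>d>0. \<forall>z z'. \<bar>s z - s z'\<bar> < d \<longrightarrow> dist z z' < e"
    using compact_metric_real_code[OF comp] by metis
  define K where "K = closure (range s)"
  obtain g where g: "continuous_on K g" and gs: "\<And>z. g (s z) = z"
    using real_code_inverse[OF comp uni] unfolding K_def by metis
  have sK: "s z \<in> K" for z unfolding K_def by (rule subsetD[OF closure_subset]) simp
  have "closed K" "K \<noteq> {}" unfolding K_def by auto
  have "K \<subseteq> {0..2}" unfolding K_def using s02 by (intro closure_minimal) auto
  then have "compact K"
    using \<open>closed K\<close> by (metis closed_Int_compact compact_Icc inf.absorb1)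
  define L where "L n = distr (M n) borel s" for n
  have sM[measurable]: "s \<in> borel_measurable (M n)" for n
    using M[of n] s unfolding borel_prob_def by (simp cong: measurable_cong_sets)
  have rd: "real_distribution (L n)" for n
    unfolding L_def using M[of n] sM
    by (auto simp: borel_prob_def intro!: prob_space.real_distribution_distr)
  have int_L: "(\<integral>x. F x \<partial>L n) = (\<integral>z. F (s z) \<partial>M n)" if "F \<in> borel_measurable borel" for F :: "real \<Rightarrow> real" and n
    unfolding L_def using that by (intro integral_distr) auto
  have "tight L"
    unfolding tight_def
  proof (intro conjI allI impI rd)
    fix \<epsilon> :: real assume "\<epsilon> > 0"
    \<comment> \<open>Tightness is phrased with half-open intervals, and the code may take the value
      0; hence the left end -1.\<close>
    have "measure (L n) {-1<..2} = 1" for n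
    proof -
      have "s -` {-1<..2} = UNIV"
      proof -
        have "s z \<in> {-1<..2}" for z using s02[of z] by simp
        then show ?thesis by auto
      qed
      moreover have "measure (M n) (space (M n)) = 1"
        using M[of n] unfolding borel_prob_def by (auto intro: prob_space.prob_space)
      ultimately show ?thesis unfolding L_def by (subst measure_distr) auto
    qed
    then show "\<exists>a b. a < b \<and> (\<forall>n. 1 - \<epsilon> < measure (L n) {a<..b})"
      using \<open>\<epsilon> > 0\<close> by (intro exI[of _ "-1"] exI[of _ 2]) auto
  qed
  from tight_imp_convergent_subsubsequence[OF this strict_mono_id]
  obtain r N' where r: "strict_mono (r :: nat \<Rightarrow> nat)" and N': "real_distribution N'"
    and conv: "weak_conv_m (L \<circ> r) N'" by auto
  interpret N': real_distribution N' by fact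
  have lim: "(\<lambda>n. \<integral>z. F (s z) \<partial>M (r n)) \<longlonglongrightarrow> (\<integral>x. F x \<partial>N')"
    if F: "continuous_on UNIV F" and B: "\<And>x. norm (F x) \<le> B" for F :: "real \<Rightarrow> real" and B
  proof -
    have "(\<lambda>n. \<integral>x. F x \<partial>(L \<circ> r) n) \<longlonglongrightarrow> (\<integral>x. F x \<partial>N')"
      by (rule weak_conv_imp_integral_bdd_continuous_conv[OF _ N' conv])
         (use rd B F in \<open>auto simp: continuous_on_eq_continuous_within\<close>)
    then show ?thesis
      using int_L[OF borel_measurable_continuous_onI[OF F]] by (simp add: o_def)
  qed
  \<comment> \<open>The truncated distance to \<open>K\<close> is a bounded continuous test function
    that vanishes on every code, so its integral under the limit is 0.\<close>
  have "AE x in N'. x \<in> K"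
  proof -
    define F where "F x = min 1 (infdist x K)" for x
    have cF: "continuous_on UNIV F" unfolding F_def by (intro continuous_intros)
    have "F (s z) = 0" for z
      unfolding F_def using sK[of z] by simp
    moreover have bF: "norm (F x) \<le> 1" for x unfolding F_def by (simp add: infdist_nonneg)
    ultimately have "(\<integral>x. F x \<partial>N') = 0"
      using lim[OF cF, of 1] by (simp add: LIMSEQ_const_iff)
    moreover have "integrable N' F"
      using bF borel_measurable_continuous_onI[OF cF]
      by (intro N'.integrable_const_bound[of _ 1]) (auto simp: measurable_def)
    ultimately have "AE x in N'. F x = 0"
      by (subst (asm) integral_nonneg_eq_0_iff_AE) (auto simp: F_def infdist_nonneg)
    then show ?thesis
      by eventually_elim
        (auto simp: F_def min_def in_closed_iff_infdist_zero[OF \<open>closed K\<close> \<open>K \<noteq> {}\<close>] split: if_splits)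
  qed
  \<comment> \<open>\<open>h\<close> is a Borel left inverse of \<open>s\<close>, so the push-forward of \<open>N'\<close> under \<open>h\<close> is the limit.\<close>
  define h where "h x = (if x \<in> K then g x else g (s undefined))" for x
  have hb: "h \<in> borel_measurable borel"
    unfolding h_def[abs_def] using \<open>closed K\<close> borel_measurable_continuous_on_restrict[OF g]
    by (subst measurable_restrict_space_iff[symmetric]) auto
  then have h[measurable]: "h \<in> borel_measurable N'"
    by (simp cong: measurable_cong_sets)
  show thesis
  proof
    show "strict_mono r" by fact
    show "borel_prob (distr N' borel h)"
      unfolding borel_prob_def by (auto intro!: N'.prob_space_distr)
    fix f :: "'a \<Rightarrow> real" assume f: "continuous_on UNIV f"
    have fb: "f \<in> borel_measurable borel" using f by (rule borel_measurable_continuous_onI)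
    have fg: "continuous_on K (\<lambda>x. f (g x))"
      by (rule continuous_on_compose2[OF f g]) auto
    have "bounded ((\<lambda>x. f (g x)) ` K)"
      by (intro compact_imp_bounded compact_continuous_image fg \<open>compact K\<close>)
    then obtain B where B: "B > 0" "\<And>x. x \<in> K \<Longrightarrow> norm (f (g x)) \<le> B"
      unfolding bounded_pos by blast
    \<comment> \<open>Tietze extends \<open>f\<close> composed with \<open>g\<close> from
      \<open>K\<close> to the line with the same bound. On codes the extension returns
      \<open>f\<close>, so weak convergence on the line applies to it.\<close>
    obtain F where F: "continuous_on UNIV F" "\<And>x. x \<in> K \<Longrightarrow> F x = f (g x)" "\<And>x. norm (F x) \<le> B"
      using Tietze[of K "\<lambda>x. f (g x)" UNIV B] fg \<open>closed K\<close> B by auto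
    have Fb: "F \<in> borel_measurable N'"
      using borel_measurable_continuous_onI[OF F(1)] by (simp cong: measurable_cong_sets)
    have "F (s z) = f z" for z using F(2)[OF sK] gs by simp
    then have "(\<lambda>n. \<integral>x. f x \<partial>M (r n)) \<longlonglongrightarrow> (\<integral>x. F x \<partial>N')"
      using lim[OF F(1,3)] by simp
    moreover have "(\<integral>x. F x \<partial>N') = (\<integral>x. f (h x) \<partial>N')"
    proof (rule integral_cong_AE[OF Fb measurable_compose[OF h fb]])
      show "AE x in N'. F x = f (h x)"
        using \<open>AE x in N'. x \<in> K\<close> by eventually_elim (simp add: F(2) h_def)
    qed
    moreover have "\<dots> = (\<integral>x. f x \<partial>distr N' borel h)"
      using h fb by (simp add: integral_distr)
    ultimately show "(\<lambda>n. \<integral>x. f x \<partial>M (r n)) \<longlonglongrightarrow> (\<integral>x. f x \<partial>distr N' borel h)" by simp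
  qed
qed

section \<open>Borel structure of the square and uniqueness of measures\<close>

text \<open>Couplings live on the product sigma-algebra, whereas weak compactness on the square
  yields Borel measures and the distance is a Borel function there. A countable base makes every
  open set a countable union of rectangles, so the two settings agree.\<close>

lemma sets_borel_pair_compact:
  assumes "compact (UNIV :: 'a::metric_space set)"
  shows "sets (borel \<Otimes>\<^sub>M borel) = sets (borel :: ('a \<times> 'a::metric_space) measure)"
proof (rule antisym)
  show "sets (borel \<Otimes>\<^sub>M borel) \<subseteq> sets (borel :: ('a \<times> 'a) measure)"
  proof (rule sets_pair_in_sets)
    fix a b :: "'a set" assume ab: "a \<in> sets borel" "b \<in> sets borel"
    have [measurable]: "fst \<in> measurable (borel :: ('a \<times> 'a) measure) borel"
      "snd \<in> measurable (borel :: ('a \<times> 'a) measure) borel"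
      by (auto intro!: borel_measurable_continuous_onI continuous_intros)
    have "fst -` a \<inter> snd -` b \<inter> space borel \<in> sets (borel :: ('a \<times> 'a) measure)"
      using measurable_sets[of fst "borel :: ('a \<times> 'a) measure" borel a]
        measurable_sets[of snd "borel :: ('a \<times> 'a) measure" borel b] ab by auto
    moreover have "fst -` a \<inter> snd -` b \<inter> space borel = a \<times> b" by auto
    ultimately show "a \<times> b \<in> sets (borel :: ('a \<times> 'a) measure)" by simp
  qed
  obtain B :: "nat \<Rightarrow> 'a set" where B: "\<And>n. open (B n)"
      "\<And>x U. open U \<Longrightarrow> x \<in> U \<Longrightarrow> \<exists>n. x \<in> B n \<and> B n \<subseteq> U"
    using compact_countable_basis[OF assms] by metis
  have "U \<in> sets (borel \<Otimes>\<^sub>M borel)" if U: "open U" for U :: "('a \<times> 'a) set"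
  proof -
    have "U = (\<Union>p\<in>{p. B (fst p) \<times> B (snd p) \<subseteq> U}. B (fst p) \<times> B (snd p))"
    proof (intro equalityI subsetI)
      fix z assume "z \<in> U"
      then obtain V W where VW: "open V" "open W" "z \<in> V \<times> W" "V \<times> W \<subseteq> U"
        using U by (metis open_prod_elim)
      then obtain m n where "fst z \<in> B m" "B m \<subseteq> V" "snd z \<in> B n" "B n \<subseteq> W"
        using B(2)[of V "fst z"] B(2)[of W "snd z"] by (auto simp: mem_Times_iff)
      then have "z \<in> B m \<times> B n" "B m \<times> B n \<subseteq> U"
        using VW(4) by (auto simp: mem_Times_iff)
      then show "z \<in> (\<Union>p\<in>{p. B (fst p) \<times> B (snd p) \<subseteq> U}. B (fst p) \<times> B (snd p))"
        by (intro UN_I[of "(m, n)"]) auto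
    qed blast
    also have "\<dots> \<in> sets (borel \<Otimes>\<^sub>M borel)"
      using B(1) by (intro sets.countable_UN' pair_measureI) auto
    finally show ?thesis .
  qed
  then show "sets (borel :: ('a \<times> 'a) measure) \<subseteq> sets (borel \<Otimes>\<^sub>M borel)"
    using sets.sigma_sets_subset[of "{U. open U}" "borel \<Otimes>\<^sub>M (borel :: 'a measure)"]
    by (auto simp: borel_def[where 'a="'a \<times> 'a"] space_pair_measure)
qed

text \<open>Closed sets generate the Borel sets and are stable under intersection, and the indicator
  of a closed set is a pointwise limit of bounded continuous functions. It identifies the marginals
  of a weak limit.\<close>

lemma measure_eqI_integral_continuous:
  fixes M N :: "'a::metric_space measure"
  assumes M: "borel_prob M" and N: "borel_prob N"
    and eq: "\<And>f :: 'a \<Rightarrow> real. continuous_on UNIV f \<Longrightarrow> bounded (range f) \<Longrightarrow>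
               (\<integral>x. f x \<partial>M) = (\<integral>x. f x \<partial>N)"
  shows "M = N"
proof (rule measure_eqI_generator_eq[where E="Collect closed" and \<Omega>=UNIV and A="\<lambda>_. UNIV"])
  show "sets M = sigma_sets UNIV (Collect closed)" "sets N = sigma_sets UNIV (Collect closed)"
    using M N by (auto simp: borel_prob_def borel_eq_closed)
  show "emeasure M UNIV \<noteq> \<infinity>"
    using M prob_space.emeasure_space_1[of M] sets_eq_imp_space_eq[of M borel]
    by (auto simp: borel_prob_def)
  fix C :: "'a set" assume "C \<in> Collect closed"
  then have C: "closed C" by simp
  show "emeasure M C = emeasure N C"
  \<comment> \<open>The empty set is separated because \<open>infdist x {}\<close> is 0 by
    convention, so the approximating functions would be constantly 1.\<close>
  proof (cases "C = {}")
    case False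
    define f where "f n x = max 0 (1 - real n * infdist x C)" for n x
    have cf: "continuous_on UNIV (f n)" for n
      unfolding f_def by (intro continuous_intros)
    have bf: "norm (f n x) \<le> 1" for n x
      unfolding f_def by (auto simp: infdist_nonneg)
    have lim: "(\<lambda>n. f n x) \<longlonglongrightarrow> indicator C x" for x
    proof (cases "x \<in> C")
      case True
      then show ?thesis by (simp add: f_def)
    next
      case False
      then have pos: "infdist x C > 0" by (intro infdist_pos_not_in_closed[OF C \<open>C \<noteq> {}\<close>])
      obtain n where n: "1 < real n * infdist x C" using reals_Archimedean3[OF pos] by blast
      have "f m x = 0" if "m \<ge> n" for m
      proof -
        have "real n * infdist x C \<le> real m * infdist x C"
          using that pos by (intro mult_right_mono) auto
        then show ?thesis using n unfolding f_def by simp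
      qed
      then have "\<forall>\<^sub>F m in sequentially. f m x = indicator C x"
        using False by (auto simp: eventually_sequentially)
      then show ?thesis by (rule tendsto_eventually)
    qed
    have *: "(\<lambda>n. \<integral>x. f n x \<partial>P) \<longlonglongrightarrow> measure P C" if P: "borel_prob P" for P
    proof -
      interpret prob_space P using P by (simp add: borel_prob_def)
      have sP: "sets P = sets borel" using P by (simp add: borel_prob_def)
      have "(\<lambda>n. \<integral>x. f n x \<partial>P) \<longlonglongrightarrow> (\<integral>x. indicator C x \<partial>P)"
      proof (rule integral_dominated_convergence[where w="\<lambda>_. 1"])
        show "f n \<in> borel_measurable P" for n
          using borel_measurable_continuous_onI[OF cf] sP by (simp cong: measurable_cong_sets)
        show "(indicator C :: 'a \<Rightarrow> real) \<in> borel_measurable P" 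
          using C sP by (intro borel_measurable_indicator) simp
      qed (use lim bf in auto)
      also have "(\<integral>x. indicator C x \<partial>P) = measure P C"
        using sets_eq_imp_space_eq[OF sP] by simp
      finally show ?thesis .
    qed
    have "(\<integral>x. f n x \<partial>M) = (\<integral>x. f n x \<partial>N)" for n
      using bf by (intro eq cf) (auto simp: bounded_iff)
    then have "measure M C = measure N C"
      using *[OF M] *[OF N] LIMSEQ_unique by auto
    then show ?thesis
      using M N by (simp add: borel_prob_def finite_measure.emeasure_eq_measure prob_space.finite_measure)
  qed simp
qed (auto simp: Int_stable_def)

lemma borel_measurable_dist_compact:
  fixes X Y :: "'b \<Rightarrow> 'a::metric_space"
  assumes comp: "compact (UNIV :: 'a set)"
    and [measurable]: "X \<in> borel_measurable M" "Y \<in> borel_measurable M"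
  shows "(\<lambda>\<omega>. dist (X \<omega>) (Y \<omega>)) \<in> borel_measurable M"
proof -
  have "(\<lambda>z :: 'a \<times> 'a. dist (fst z) (snd z)) \<in> borel_measurable borel"
    by (intro borel_measurable_continuous_onI continuous_intros)
  then have [measurable]: "(\<lambda>z :: 'a \<times> 'a. dist (fst z) (snd z)) \<in> borel_measurable (borel \<Otimes>\<^sub>M borel)"
    using sets_borel_pair_compact[OF comp] by (simp cong: measurable_cong_sets)
  have "(\<lambda>\<omega>. (\<lambda>z. dist (fst z) (snd z)) (X \<omega>, Y \<omega>)) \<in> borel_measurable M"
    by measurable
  then show ?thesis by simp
qed

lemma (in prob_space) integrable_dist_compact:
  fixes X Y :: "'a \<Rightarrow> 'b::metric_space"
  assumes comp: "compact (UNIV :: 'b set)"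
    and "X \<in> borel_measurable M" "Y \<in> borel_measurable M"
  shows "integrable M (\<lambda>\<omega>. dist (X \<omega>) (Y \<omega>))"
proof -
  have "norm (dist x y) \<le> diameter (UNIV :: 'b set)" for x y :: 'b
    using diameter_bounded_bound[OF compact_imp_bounded[OF comp], of x y] by simp
  then show ?thesis
    using assms by (intro integrable_const_bound AE_I2 borel_measurable_dist_compact)
qed

section \<open>Couplings and existence of an optimal one\<close>

lemma couplings_borel_iff:
  assumes "borel_prob \<mu>" "borel_prob \<nu>"
  shows "\<pi> \<in> couplings \<mu> \<nu> \<longleftrightarrow> prob_space \<pi> \<and> sets \<pi> = sets (borel \<Otimes>\<^sub>M borel) \<and>
    distr \<pi> borel fst = \<mu> \<and> distr \<pi> borel snd = \<nu>"
proof -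
  have s: "sets \<mu> = sets borel" "sets \<nu> = sets borel"
    using assms by (auto simp: borel_prob_def)
  have "sets (\<mu> \<Otimes>\<^sub>M \<nu>) = sets (borel \<Otimes>\<^sub>M borel)"
    using s by (rule sets_pair_measure_cong)
  moreover have "distr \<pi> \<mu> fst = distr \<pi> borel fst" "distr \<pi> \<nu> snd = distr \<pi> borel snd"
    using s by (auto intro: distr_cong)
  ultimately show ?thesis unfolding couplings_def by simp
qed

lemma (in prob_space) distr_Pair_in_couplings:
  assumes [measurable]: "X \<in> borel_measurable M" "Y \<in> borel_measurable M"
  shows "distr M (borel \<Otimes>\<^sub>M borel) (\<lambda>\<omega>. (X \<omega>, Y \<omega>)) \<in> couplings (distr M borel X) (distr M borel Y)"
proof -
  have "borel_prob (distr M borel X)" "borel_prob (distr M borel Y)"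
    unfolding borel_prob_def by (auto intro!: prob_space_distr)
  then show ?thesis
    by (subst couplings_borel_iff) (auto intro!: prob_space_distr simp: distr_distr o_def)
qed

lemma transport_cost_nonneg: "0 \<le> transport_cost \<pi>"
  unfolding transport_cost_def by simp

text \<open>The direct method: a minimizing sequence of couplings has a weak limit, the marginal
  constraints and the cost are continuous under weak convergence, and so the infimum is attained.
  This is what gives \<open>LEAST\<close> in \<open>wasserstein\<close> its meaning.\<close>

lemma optimal_coupling:
  fixes \<mu> \<nu> :: "'a::metric_space measure"
  assumes comp: "compact (UNIV :: 'a set)" and \<mu>: "borel_prob \<mu>" and \<nu>: "borel_prob \<nu>"
  obtains \<pi> where "\<pi> \<in> couplings \<mu> \<nu>" "transport_cost \<pi> = wasserstein \<mu> \<nu>"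
    "\<And>\<pi>'. \<pi>' \<in> couplings \<mu> \<nu> \<Longrightarrow> wasserstein \<mu> \<nu> \<le> transport_cost \<pi>'"
proof -
  note cpl = couplings_borel_iff[OF \<mu> \<nu>]
  interpret \<mu>: prob_space \<mu> using \<mu> by (simp add: borel_prob_def)
  interpret \<nu>: prob_space \<nu> using \<nu> by (simp add: borel_prob_def)
  interpret \<mu>\<nu>: pair_prob_space \<mu> \<nu> ..
  have [measurable_cong]: "sets \<mu> = sets borel" "sets \<nu> = sets borel"
    using \<mu> \<nu> by (auto simp: borel_prob_def)
  \<comment> \<open>The independent coupling is a witness. Without one, the infimum below would be
    taken over an empty set.\<close>
  have ne: "couplings \<mu> \<nu> \<noteq> {}"
  proof -
    have "distr (\<mu> \<Otimes>\<^sub>M \<nu>) borel fst = \<mu>"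
      using \<nu>.distr_pair_fst[of \<mu>] by (metis \<open>sets \<mu> = sets borel\<close> distr_cong)
    moreover have "distr (\<mu> \<Otimes>\<^sub>M \<nu>) borel snd = \<nu>"
    proof -
      have "distr (\<mu> \<Otimes>\<^sub>M \<nu>) borel snd = distr (distr (\<nu> \<Otimes>\<^sub>M \<mu>) (\<mu> \<Otimes>\<^sub>M \<nu>) (\<lambda>(x, y). (y, x))) borel snd"
        using \<mu>\<nu>.distr_pair_swap by simp
      also have "\<dots> = distr (\<nu> \<Otimes>\<^sub>M \<mu>) \<nu> fst"
        by (subst distr_distr) (auto intro!: distr_cong simp: \<open>sets \<nu> = sets borel\<close> space_pair_measure)
      also have "\<dots> = \<nu>" by (rule \<mu>.distr_pair_fst)
      finally show ?thesis .
    qed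
    ultimately show ?thesis
      using \<mu>\<nu>.distr_Pair_in_couplings[of fst snd] by auto
  qed
  define c where "c = Inf (transport_cost ` couplings \<mu> \<nu>)"
  have bdd: "bdd_below (transport_cost ` couplings \<mu> \<nu>)"
    by (intro bdd_belowI2[of _ 0] transport_cost_nonneg)
  have "\<exists>\<pi>\<in>couplings \<mu> \<nu>. transport_cost \<pi> < c + 1 / real (Suc n)" for n
  proof -
    have "Inf (transport_cost ` couplings \<mu> \<nu>) < c + 1 / real (Suc n)"
      unfolding c_def by simp
    from cInf_lessD[OF _ this] ne show ?thesis by auto
  qed
  then obtain M where M: "\<And>n. M n \<in> couplings \<mu> \<nu>"
      "\<And>n. transport_cost (M n) < c + 1 / real (Suc n)"
    by metis
  \<comment> \<open>The compactness result is applied to the square, itself a compact metric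
    space.\<close>
  have comp2: "compact (UNIV :: ('a \<times> 'a) set)"
    using compact_Times[OF comp comp] by simp
  have bM: "borel_prob (M n)" for n
    using M(1)[of n] unfolding cpl borel_prob_def sets_borel_pair_compact[OF comp] by simp
  obtain r N where r: "strict_mono r" and N: "borel_prob N"
    and lim: "\<And>f :: 'a \<times> 'a \<Rightarrow> real. continuous_on UNIV f \<Longrightarrow>
       (\<lambda>n. \<integral>x. f x \<partial>M (r n)) \<longlonglongrightarrow> (\<integral>x. f x \<partial>N)"
    by (rule compact_prob_convergent_subseq[OF comp2, of M, OF bM], rule that) blast+
  interpret N: prob_space N using N by (simp add: borel_prob_def)
  \<comment> \<open>A continuous test function composed with a projection is again a continuous test
    function, and its integrals are constant along the sequence. Stated for a general
    \<open>p\<close>, it covers both projections.\<close>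
  have marginal: "distr N borel p = \<rho>"
    if p: "continuous_on UNIV p" and \<rho>: "borel_prob \<rho>" and Mp: "\<And>n. distr (M n) borel p = \<rho>"
    for p :: "'a \<times> 'a \<Rightarrow> 'a" and \<rho>
  proof (rule measure_eqI_integral_continuous[OF _ \<rho>])
    have pm: "p \<in> borel_measurable P" if "borel_prob P" for P
      using that borel_measurable_continuous_onI[OF p] unfolding borel_prob_def
      by (simp cong: measurable_cong_sets)
    show "borel_prob (distr N borel p)"
      unfolding borel_prob_def using pm[OF N] by (auto intro!: N.prob_space_distr)
    fix f :: "'a \<Rightarrow> real" assume f: "continuous_on UNIV f"
    have fm: "f \<in> borel_measurable borel" using f by (rule borel_measurable_continuous_onI)
    have "(\<integral>x. f (p x) \<partial>M (r n)) = (\<integral>x. f x \<partial>\<rho>)" for n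
      using integral_distr[OF pm[OF bM] fm, of "r n"] Mp by simp
    moreover have "continuous_on UNIV (\<lambda>x. f (p x))"
      by (rule continuous_on_compose2[OF f p]) auto
    ultimately have "(\<integral>x. f (p x) \<partial>N) = (\<integral>x. f x \<partial>\<rho>)"
      using lim[of "\<lambda>x. f (p x)"] by (simp add: LIMSEQ_const_iff)
    then show "(\<integral>x. f x \<partial>distr N borel p) = (\<integral>x. f x \<partial>\<rho>)"
      using integral_distr[OF pm[OF N] fm] by simp
  qed
  have Nc: "N \<in> couplings \<mu> \<nu>"
    unfolding cpl using N M(1) \<mu> \<nu> unfolding cpl borel_prob_def sets_borel_pair_compact[OF comp]
    by (auto intro!: marginal continuous_intros simp: borel_prob_def)
  have "(\<lambda>n. transport_cost (M (r n))) \<longlonglongrightarrow> transport_cost N"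
    unfolding transport_cost_def by (intro lim continuous_intros)
  moreover have "transport_cost (M (r n)) \<le> c + 1 / real (Suc n)" for n
  proof -
    have "transport_cost (M (r n)) \<le> c + 1 / real (Suc (r n))"
      using M(2)[of "r n"] by simp
    also have "\<dots> \<le> c + 1 / real (Suc n)"
      using seq_suble[OF r, of n] by (intro add_left_mono divide_left_mono) auto
    finally show ?thesis .
  qed
  moreover have "(\<lambda>n. c + 1 / real (Suc n)) \<longlonglongrightarrow> c + 0"
    by (intro tendsto_intros LIMSEQ_Suc[OF lim_1_over_n])
  ultimately have "transport_cost N \<le> c + 0"
    by (intro LIMSEQ_le) auto
  moreover have c_le: "c \<le> transport_cost \<pi>" if "\<pi> \<in> couplings \<mu> \<nu>" for \<pi>
    unfolding c_def using bdd that by (intro cInf_lower) auto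
  ultimately have Nc2: "transport_cost N = c" using c_le[OF Nc] by simp
  have "wasserstein \<mu> \<nu> = c"
    unfolding wasserstein_def using Nc Nc2 c_le by (intro Least_equality) auto
  then show thesis using that[OF Nc] Nc2 c_le by simp
qed

text \<open>Every later upper bound on the distance goes through this: realize both laws on one
  probability space and estimate the expected distance there.\<close>

lemma (in prob_space) wasserstein_distr_le:
  fixes X Y :: "'a \<Rightarrow> 'b::metric_space"
  assumes comp: "compact (UNIV :: 'b set)"
    and [measurable]: "X \<in> borel_measurable M" "Y \<in> borel_measurable M"
  shows "wasserstein (distr M borel X) (distr M borel Y) \<le> (\<integral>\<omega>. dist (X \<omega>) (Y \<omega>) \<partial>M)"
proof -
  have "borel_prob (distr M borel X)" "borel_prob (distr M borel Y)"
    unfolding borel_prob_def by (auto intro!: prob_space_distr)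
  then have "wasserstein (distr M borel X) (distr M borel Y)
      \<le> transport_cost (distr M (borel \<Otimes>\<^sub>M borel) (\<lambda>\<omega>. (X \<omega>, Y \<omega>)))"
    using distr_Pair_in_couplings[of X Y] optimal_coupling[OF comp, of "distr M borel X" "distr M borel Y"]
      assms(2,3) by metis
  also have "\<dots> = (\<integral>\<omega>. dist (X \<omega>) (Y \<omega>) \<partial>M)"
    unfolding transport_cost_def
    by (subst integral_distr) (auto intro!: borel_measurable_dist_compact[OF comp])
  finally show ?thesis .
qed

section \<open>Approximate gluing and the triangle inequality\<close>

text \<open>The cells are the preimages under the code of grid intervals of length \<open>d\<close>.
  Integer labels keep the partition countable, so that null cells can be discarded together.\<close>

lemma compact_small_cells:
  assumes comp: "compact (UNIV :: 'a::metric_space set)" and "e > 0"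
  obtains c :: "'a::metric_space \<Rightarrow> int"
  where "c \<in> measurable borel (count_space UNIV)" "\<And>y y'. c y = c y' \<Longrightarrow> dist y y' < e"
proof -
  obtain s :: "'a \<Rightarrow> real" where s[measurable]: "s \<in> borel_measurable borel"
    and uni: "\<And>e. e > 0 \<Longrightarrow> \<exists>d>0. \<forall>z z'. \<bar>s z - s z'\<bar> < d \<longrightarrow> dist z z' < e"
    using compact_metric_real_code[OF comp] by metis
  obtain d where d: "d > 0" "\<And>z z'. \<bar>s z - s z'\<bar> < d \<Longrightarrow> dist z z' < e"
    using uni[OF \<open>e > 0\<close>] by blast
  show thesis
  proof
    show "(\<lambda>z. \<lfloor>s z / d\<rfloor>) \<in> measurable borel (count_space UNIV)" by measurable
    fix y y' assume "\<lfloor>s y / d\<rfloor> = \<lfloor>s y' / d\<rfloor>"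
    then have "\<bar>s y / d - s y' / d\<bar> < 1" by linarith
    then have "\<bar>s y - s y'\<bar> < d"
      using d(1) by (simp add: diff_divide_distrib[symmetric] field_simps)
    then show "dist y y' < e" by (rule d(2))
  qed
qed

text \<open>The integrand is the density of the conditional law given \<open>A = i\<close>; it
  appears as the inner integral for both marginals of the gluing.\<close>

lemma (in prob_space) nn_integral_normalized_fibre:
  assumes A[measurable]: "A \<in> measurable M (count_space UNIV)"
    and "prob {x \<in> space M. A x = i} \<noteq> 0"
  shows "(\<integral>\<^sup>+x. (if A x = i then ennreal (1 / prob {x \<in> space M. A x = i}) else 0) \<partial>M) = 1"
proof -
  let ?S = "{x \<in> space M. A x = i}"
  have [measurable]: "?S \<in> sets M" by measurable
  have "(\<integral>\<^sup>+x. (if A x = i then ennreal (1 / prob ?S) else 0) \<partial>M)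
      = (\<integral>\<^sup>+x. ennreal (1 / prob ?S) * indicator ?S x \<partial>M)"
    by (intro nn_integral_cong) (auto simp: indicator_def)
  also have "\<dots> = ennreal (1 / prob ?S) * ennreal (prob ?S)"
    by (subst nn_integral_cmult_indicator) (auto simp: emeasure_eq_measure)
  also have "\<dots> = 1"
    using assms(2) by (simp add: ennreal_mult[symmetric])
  finally show ?thesis .
qed

lemma (in prob_space) AE_fibre_pos:
  fixes A :: "'a \<Rightarrow> 'i::countable"
  assumes A[measurable]: "A \<in> measurable M (count_space UNIV)"
  shows "AE x in M. prob {y \<in> space M. A y = A x} \<noteq> 0"
proof -
  have "AE x in M. prob {y \<in> space M. A y = i} = 0 \<longrightarrow> A x \<noteq> i" for i
  proof (cases "prob {y \<in> space M. A y = i} = 0")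
    case True
    then have "{y \<in> space M. A y = i} \<in> null_sets M"
      by (auto simp: null_sets_def emeasure_eq_measure)
    then show ?thesis by (intro AE_I'[of "{y \<in> space M. A y = i}"]) auto
  qed simp
  then have "AE x in M. \<forall>i. prob {y \<in> space M. A y = i} = 0 \<longrightarrow> A x \<noteq> i"
    unfolding AE_all_countable by blast
  then show ?thesis by eventually_elim auto
qed

text \<open>Draw a cell according to the common law of \<open>Y\<close> and \<open>Z\<close>, then
  draw the two points independently from \<open>P\<close> and from \<open>Q\<close>, each
  conditioned on that cell. Averaging over cells restores \<open>P\<close> and \<open>Q\<close>, and
  sharing a cell forces the distance below \<open>e\<close>.\<close>

lemma approximate_gluing:
  fixes Y :: "'p \<Rightarrow> 'a::metric_space" and Z :: "'q \<Rightarrow> 'a"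
  assumes comp: "compact (UNIV :: 'a set)" and "prob_space P" "prob_space Q"
    and Y[measurable]: "Y \<in> borel_measurable P" and Z[measurable]: "Z \<in> borel_measurable Q"
    and eq: "distr P borel Y = distr Q borel Z" and "e > 0"
  obtains G where "G \<in> couplings P Q" "AE w in G. dist (Y (fst w)) (Z (snd w)) < e"
proof -
  interpret P: prob_space P by fact
  interpret Q: prob_space Q by fact
  interpret PQ: pair_prob_space P Q ..
  obtain c :: "'a \<Rightarrow> int" where c[measurable]: "c \<in> measurable borel (count_space UNIV)"
    and c_dist: "\<And>y y'. c y = c y' \<Longrightarrow> dist y y' < e"
    using compact_small_cells[OF comp \<open>e > 0\<close>] by metis
  define p where "p i = measure (distr P borel Y) {y. c y = i}" for i
  have [measurable]: "{y. c y = i} \<in> sets borel" for i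
    using measurable_sets[OF c, of "{i}"] by (simp add: vimage_def)
  have pP: "P.prob {x \<in> space P. c (Y x) = i} = p i" for i
    unfolding p_def by (subst measure_distr) (auto intro!: arg_cong[where f=P.prob])
  \<comment> \<open>Equality of the two laws enters here: the same weights \<open>p\<close>
    normalize the cells of \<open>Q\<close>.\<close>
  have pQ: "Q.prob {x \<in> space Q. c (Z x) = i} = p i" for i
    unfolding p_def eq by (subst measure_distr) (auto intro!: arg_cong[where f=Q.prob])
  \<comment> \<open>Under the density \<open>h\<close>, the two factors are independent given their common cell;
    cells with \<open>p i = 0\<close>, where \<open>1 / p i = 0\<close>, are negligible.\<close>
  define h where "h w = (if c (Y (fst w)) = c (Z (snd w)) then ennreal (1 / p (c (Y (fst w)))) else 0)" for w
  have h[measurable]: "h \<in> borel_measurable (P \<Otimes>\<^sub>M Q)"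
    unfolding h_def[abs_def] by measurable
  have h1: "AE x in P. (\<integral>\<^sup>+y. h (x, y) \<partial>Q) = 1"
  proof -
    have "AE x in P. p (c (Y x)) \<noteq> 0"
      using P.AE_fibre_pos[of "\<lambda>x. c (Y x)"] unfolding pP by simp
    then show ?thesis
    proof eventually_elim
      case (elim x)
      have "h (x, y) = (if c (Z y) = c (Y x) then ennreal (1 / p (c (Y x))) else 0)" for y
        unfolding h_def by auto
      then show ?case
        using Q.nn_integral_normalized_fibre[of "\<lambda>y. c (Z y)" "c (Y x)"] elim
        unfolding pQ by simp
    qed
  qed
  have h2: "AE y in Q. (\<integral>\<^sup>+x. h (x, y) \<partial>P) = 1"
  proof -
    have "AE y in Q. p (c (Z y)) \<noteq> 0"
      using Q.AE_fibre_pos[of "\<lambda>x. c (Z x)"] unfolding pQ by simp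
    then show ?thesis
    proof eventually_elim
      case (elim y)
      have "h (x, y) = (if c (Y x) = c (Z y) then ennreal (1 / p (c (Z y))) else 0)" for x
        unfolding h_def by auto
      then show ?case
        using P.nn_integral_normalized_fibre[of "\<lambda>x. c (Y x)" "c (Z y)"] elim
        unfolding pP by simp
    qed
  qed
  define G where "G = density (P \<Otimes>\<^sub>M Q) h"
  \<comment> \<open>By Tonelli the second coordinate is integrated out first, where
    \<open>h1\<close> gives the value 1; the other marginal uses the opposite order and
    \<open>h2\<close>.\<close>
  have fst_G: "distr G P fst = P"
  proof (rule measure_eqI)
    fix E assume "E \<in> sets (distr G P fst)"
    then have E[measurable]: "E \<in> sets P" by simp
    have "emeasure (distr G P fst) E = (\<integral>\<^sup>+w. indicator E (fst w) \<partial>G)"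
      by (subst nn_integral_indicator[of E "distr G P fst", symmetric], simp, subst nn_integral_distr)
         (auto simp: G_def)
    also have "\<dots> = (\<integral>\<^sup>+w. h w * indicator E (fst w) \<partial>(P \<Otimes>\<^sub>M Q))"
      unfolding G_def by (subst nn_integral_density) auto
    also have "\<dots> = (\<integral>\<^sup>+x. (\<integral>\<^sup>+y. h (x, y) * indicator E x \<partial>Q) \<partial>P)"
      by (subst Q.nn_integral_fst[symmetric]) auto
    also have "\<dots> = (\<integral>\<^sup>+x. indicator E x \<partial>P)"
    proof (rule nn_integral_cong_AE, use h1 in eventually_elim)
      case (elim x)
      then show ?case by (cases "x \<in> E") simp_all
    qed
    also have "\<dots> = emeasure P E" by simp
    finally show "emeasure (distr G P fst) E = emeasure P E" .
  qed simp
  have snd_G: "distr G Q snd = Q"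
  proof (rule measure_eqI)
    fix E assume "E \<in> sets (distr G Q snd)"
    then have E[measurable]: "E \<in> sets Q" by simp
    have "emeasure (distr G Q snd) E = (\<integral>\<^sup>+w. indicator E (snd w) \<partial>G)"
      by (subst nn_integral_indicator[of E "distr G Q snd", symmetric], simp, subst nn_integral_distr)
         (auto simp: G_def)
    also have "\<dots> = (\<integral>\<^sup>+w. h w * indicator E (snd w) \<partial>(P \<Otimes>\<^sub>M Q))"
      unfolding G_def by (subst nn_integral_density) auto
    also have "\<dots> = (\<integral>\<^sup>+y. (\<integral>\<^sup>+x. h (x, y) * indicator E y \<partial>P) \<partial>Q)"
      by (subst PQ.nn_integral_snd[symmetric]) auto
    also have "\<dots> = (\<integral>\<^sup>+y. indicator E y \<partial>Q)"
    proof (rule nn_integral_cong_AE, use h2 in eventually_elim)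
      case (elim y)
      then show ?case by (cases "y \<in> E") simp_all
    qed
    also have "\<dots> = emeasure Q E" by simp
    finally show "emeasure (distr G Q snd) E = emeasure Q E" .
  qed simp
  \<comment> \<open>Total mass 1 is inherited from the first marginal.\<close>
  have "prob_space G"
  proof (rule prob_space_distrD[of fst G P])
    show "fst \<in> measurable G P" unfolding G_def by simp
  qed (simp add: fst_G P.prob_space_axioms)
  then have "G \<in> couplings P Q"
    unfolding couplings_def using fst_G snd_G by (simp add: G_def)
  moreover have "AE w in G. dist (Y (fst w)) (Z (snd w)) < e"
    unfolding G_def by (subst AE_density) (auto simp: h_def intro!: AE_I2 c_dist)
  ultimately show thesis using that by blast
qed

lemma wasserstein_triangle:
  fixes \<mu> \<rho> \<nu> :: "'a::metric_space measure"
  assumes comp: "compact (UNIV :: 'a set)"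
    and \<mu>: "borel_prob \<mu>" and \<rho>: "borel_prob \<rho>" and \<nu>: "borel_prob \<nu>"
  shows "wasserstein \<mu> \<nu> \<le> wasserstein \<mu> \<rho> + wasserstein \<rho> \<nu>"
proof (rule field_le_epsilon)
  fix e :: real assume "e > 0"
  obtain \<pi> where "\<pi> \<in> couplings \<mu> \<rho>" and \<pi>_cost: "transport_cost \<pi> = wasserstein \<mu> \<rho>"
    using optimal_coupling[OF comp \<mu> \<rho>] by metis
  then have "prob_space \<pi>" and [measurable_cong]: "sets \<pi> = sets (borel \<Otimes>\<^sub>M borel)"
    and \<pi>: "distr \<pi> borel fst = \<mu>" "distr \<pi> borel snd = \<rho>"
    unfolding couplings_borel_iff[OF \<mu> \<rho>] by auto
  obtain \<sigma> where "\<sigma> \<in> couplings \<rho> \<nu>" and \<sigma>_cost: "transport_cost \<sigma> = wasserstein \<rho> \<nu>"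
    using optimal_coupling[OF comp \<rho> \<nu>] by metis
  then have "prob_space \<sigma>" and [measurable_cong]: "sets \<sigma> = sets (borel \<Otimes>\<^sub>M borel)"
    and \<sigma>: "distr \<sigma> borel fst = \<rho>" "distr \<sigma> borel snd = \<nu>"
    unfolding couplings_borel_iff[OF \<rho> \<nu>] by auto
  have [measurable]: "fst \<in> borel_measurable \<pi>" "snd \<in> borel_measurable \<pi>"
    "fst \<in> borel_measurable \<sigma>" "snd \<in> borel_measurable \<sigma>"
    by measurable
  \<comment> \<open>\<open>G\<close> is a law of quadruples ((x, y), (y', z)), with (x, y) optimal
    for the first pair of measures and (y', z) for the second. The middle points agree only up to
    \<open>e\<close>, which the four-point triangle inequality passes on as an additive
    error.\<close>
  obtain G where "G \<in> couplings \<pi> \<sigma>"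
    and G_close: "AE w in G. dist (snd (fst w)) (fst (snd w)) < e"
    by (rule approximate_gluing[OF comp \<open>prob_space \<pi>\<close> \<open>prob_space \<sigma>\<close>, of snd fst e])
       (use \<pi> \<sigma> \<open>e > 0\<close> in auto)
  then have "prob_space G" and [measurable_cong]: "sets G = sets (\<pi> \<Otimes>\<^sub>M \<sigma>)"
    and G: "distr G \<pi> fst = \<pi>" "distr G \<sigma> snd = \<sigma>"
    unfolding couplings_def by auto
  interpret G: prob_space G by fact
  have [measurable]: "fst \<in> measurable G \<pi>" "snd \<in> measurable G \<sigma>" by measurable
  have proj: "(\<lambda>w. fst (fst w)) \<in> borel_measurable G" "(\<lambda>w. snd (fst w)) \<in> borel_measurable G"
    "(\<lambda>w. fst (snd w)) \<in> borel_measurable G" "(\<lambda>w. snd (snd w)) \<in> borel_measurable G"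
    by measurable
  note int = G.integrable_dist_compact[OF comp]
  have \<mu>G: "distr G borel (\<lambda>w. fst (fst w)) = \<mu>"
    using distr_distr[of fst \<pi> borel fst G] G(1) \<pi>(1) by (simp add: o_def)
  have \<nu>G: "distr G borel (\<lambda>w. snd (snd w)) = \<nu>"
    using distr_distr[of snd \<sigma> borel snd G] G(2) \<sigma>(2) by (simp add: o_def)
  have cost1: "(\<integral>w. dist (fst (fst w)) (snd (fst w)) \<partial>G) = wasserstein \<mu> \<rho>"
    using integral_distr[of fst G \<pi> "\<lambda>z. dist (fst z) (snd z)"]
      borel_measurable_dist_compact[OF comp, of fst \<pi> snd] G(1) \<pi>_cost
    unfolding transport_cost_def by simp
  have cost2: "(\<integral>w. dist (fst (snd w)) (snd (snd w)) \<partial>G) = wasserstein \<rho> \<nu>"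
    using integral_distr[of snd G \<sigma> "\<lambda>z. dist (fst z) (snd z)"]
      borel_measurable_dist_compact[OF comp, of fst \<sigma> snd] G(2) \<sigma>_cost
    unfolding transport_cost_def by simp
  have "wasserstein \<mu> \<nu> \<le> (\<integral>w. dist (fst (fst w)) (snd (snd w)) \<partial>G)"
    using G.wasserstein_distr_le[OF comp proj(1,4)] \<mu>G \<nu>G by simp
  also have "\<dots> \<le> (\<integral>w. dist (fst (fst w)) (snd (fst w)) + dist (fst (snd w)) (snd (snd w)) + e \<partial>G)"
  proof (rule integral_mono_AE)
    show "AE w in G. dist (fst (fst w)) (snd (snd w))
        \<le> dist (fst (fst w)) (snd (fst w)) + dist (fst (snd w)) (snd (snd w)) + e"
      using G_close
    proof eventually_elim
      case (elim w)
      then show ?case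
        using dist_triangle[of "fst (fst w)" "snd (snd w)" "snd (fst w)"]
          dist_triangle[of "snd (fst w)" "snd (snd w)" "fst (snd w)"] by linarith
    qed
  qed (use int proj in auto)
  also have "\<dots> = wasserstein \<mu> \<rho> + wasserstein \<rho> \<nu> + e"
    using int proj cost1 cost2 by (simp add: G.prob_space)
  finally show "wasserstein \<mu> \<nu> \<le> wasserstein \<mu> \<rho> + wasserstein \<rho> \<nu> + e" .
qed

lemma wasserstein_nonneg:
  fixes \<mu> \<nu> :: "'a::metric_space measure"
  assumes "compact (UNIV :: 'a set)" "borel_prob \<mu>" "borel_prob \<nu>"
  shows "0 \<le> wasserstein \<mu> \<nu>"
proof -
  obtain \<pi> :: "('a \<times> 'a) measure" where "transport_cost \<pi> = wasserstein \<mu> \<nu>"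
    using optimal_coupling[OF assms] by metis
  then show ?thesis
    by (metis transport_cost_nonneg)
qed

section \<open>Mixing and the minimum\<close>

text \<open>One probability space serves both estimates: \<open>W\<close> differs from
  \<open>X\<close> only when the switch is on, which has probability \<open>t\<close>, and from
  \<open>Y\<close> only when it is off. Independence of the switch turns these probabilities into
  factors of the optimal cost.\<close>

lemma wasserstein_interpolation:
  fixes \<mu> \<nu> :: "'a::metric_space measure"
  assumes comp: "compact (UNIV :: 'a set)" and \<mu>: "borel_prob \<mu>" and \<nu>: "borel_prob \<nu>"
    and t: "0 \<le> t" "t \<le> 1"
  obtains \<xi> where "borel_prob \<xi>" "wasserstein \<mu> \<xi> \<le> t * wasserstein \<mu> \<nu>"
    "wasserstein \<xi> \<nu> \<le> (1 - t) * wasserstein \<mu> \<nu>"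
proof -
  obtain \<pi> where "\<pi> \<in> couplings \<mu> \<nu>" and cost: "transport_cost \<pi> = wasserstein \<mu> \<nu>"
    using optimal_coupling[OF comp \<mu> \<nu>] by metis
  then have "prob_space \<pi>" and [measurable_cong]: "sets \<pi> = sets (borel \<Otimes>\<^sub>M borel)"
    and \<pi>: "distr \<pi> borel fst = \<mu>" "distr \<pi> borel snd = \<nu>"
    unfolding couplings_borel_iff[OF \<mu> \<nu>] by auto
  interpret \<pi>: prob_space \<pi> by fact
  define b where "b = measure_pmf (bernoulli_pmf t)"
  interpret b: prob_space b unfolding b_def by (rule prob_space_measure_pmf)
  have [measurable_cong]: "sets b = sets (count_space UNIV)" unfolding b_def by simp
  interpret bp: pair_prob_space b \<pi> ..
  define M where "M = b \<Otimes>\<^sub>M \<pi>"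
  interpret M: prob_space M unfolding M_def by (rule bp.prob_space_axioms)
  define X Y W where "X w = fst (snd w)" and "Y w = snd (snd w)"
    and "W w = (if fst w then snd (snd w) else fst (snd w))" for w :: "bool \<times> 'a \<times> 'a"
  have [measurable]: "X \<in> borel_measurable M" "Y \<in> borel_measurable M" "W \<in> borel_measurable M"
    unfolding X_def[abs_def] Y_def[abs_def] W_def[abs_def] M_def by measurable
  have snd_M: "distr M \<pi> snd = \<pi>"
  proof (rule measure_eqI)
    fix E assume E: "E \<in> sets (distr M \<pi> snd)"
    then have "emeasure (distr M \<pi> snd) E = emeasure M (space b \<times> E)"
      using sets.sets_into_space[of E \<pi>]
      by (subst emeasure_distr) (auto simp: M_def space_pair_measure intro!: arg_cong[where f="emeasure (b \<Otimes>\<^sub>M \<pi>)"])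
    also have "\<dots> = emeasure \<pi> E"
      using E unfolding M_def by (subst \<pi>.emeasure_pair_measure_Times) (auto simp: b.emeasure_space_1)
    finally show "emeasure (distr M \<pi> snd) E = emeasure \<pi> E" .
  qed simp
  have XM: "distr M borel X = \<mu>" and YM: "distr M borel Y = \<nu>"
    using distr_distr[of fst \<pi> borel snd M] distr_distr[of snd \<pi> borel snd M] snd_M \<pi>
    by (simp_all add: M_def X_def[abs_def] Y_def[abs_def] o_def)
  \<comment> \<open>Fubini over the two values of the switch. For the distance from \<open>X\<close>
    to \<open>W\<close> the second summand is 0, and for the distance from \<open>W\<close> to
    \<open>Y\<close> the first.\<close>
  have int: "(\<integral>w. F w \<partial>M) = t * (\<integral>z. F (True, z) \<partial>\<pi>) + (1 - t) * (\<integral>z. F (False, z) \<partial>\<pi>)"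
    if "integrable M F" for F :: "bool \<times> 'a \<times> 'a \<Rightarrow> real"
    using bp.integral_fst'[of F] that t unfolding M_def b_def by (simp add: mult.commute)
  note le = M.wasserstein_distr_le[OF comp] and ib = M.integrable_dist_compact[OF comp]
  show thesis
  proof
    show "borel_prob (distr M borel W)"
      unfolding borel_prob_def by (auto intro!: M.prob_space_distr)
    show "wasserstein \<mu> (distr M borel W) \<le> t * wasserstein \<mu> \<nu>"
      using le[of X W] int[OF ib[of X W]] cost unfolding XM
      by (simp add: transport_cost_def X_def W_def)
    show "wasserstein (distr M borel W) \<nu> \<le> (1 - t) * wasserstein \<mu> \<nu>"
      using le[of W Y] int[OF ib[of W Y]] cost unfolding YM
      by (simp add: transport_cost_def Y_def W_def)
  qed
qed

theorem mainTheorem4: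
  fixes \<mu>\<^sub>0 \<nu> :: "'a::metric_space measure" and \<delta> :: real
  assumes "compact (UNIV :: 'a set)"
    and "borel_prob \<mu>\<^sub>0" and "borel_prob \<nu>"
    and "\<delta> \<ge> 0"
  shows "is_minimum {wasserstein \<mu> \<nu> |\<mu>. borel_prob \<mu> \<and> wasserstein \<mu>\<^sub>0 \<mu> \<le> \<delta>}
           (max (wasserstein \<mu>\<^sub>0 \<nu> - \<delta>) 0)"
proof -
  let ?w = "wasserstein \<mu>\<^sub>0 \<nu>"
  have lower: "max (?w - \<delta>) 0 \<le> wasserstein \<mu> \<nu>"
    if "borel_prob \<mu>" "wasserstein \<mu>\<^sub>0 \<mu> \<le> \<delta>" for \<mu>
    using wasserstein_triangle[OF assms(1,2) that(1) assms(3)] that(2)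
      wasserstein_nonneg[OF assms(1) that(1) assms(3)] by simp
  \<comment> \<open>The ratio spends the whole budget: the mixture is then at distance at most
    \<delta> from the first measure and at most \<open>?w\<close> - \<delta> from the second. If
    \<open>?w\<close> is within the budget, the choice 1 goes all the way; this case also absorbs
    \<open>?w\<close> = 0, so the division is by a positive number.\<close>
  define t where "t = (if ?w \<le> \<delta> then 1 else \<delta> / ?w)"
  have t: "0 \<le> t" "t \<le> 1" "t * ?w \<le> \<delta>" "(1 - t) * ?w \<le> max (?w - \<delta>) 0"
    using assms(4) by (auto simp: t_def field_simps)
  obtain \<xi> where "borel_prob \<xi>" "wasserstein \<mu>\<^sub>0 \<xi> \<le> t * ?w" "wasserstein \<xi> \<nu> \<le> (1 - t) * ?w"
    using wasserstein_interpolation[OF assms(1-3) t(1,2)] by metis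
  then have \<xi>: "borel_prob \<xi>" "wasserstein \<mu>\<^sub>0 \<xi> \<le> \<delta>" "wasserstein \<xi> \<nu> \<le> max (?w - \<delta>) 0"
    using t(3,4) by linarith+
  then have "wasserstein \<xi> \<nu> = max (?w - \<delta>) 0"
    using lower by (intro antisym)
  then show ?thesis
    unfolding is_minimum_def using \<xi>(1,2) lower by force
qed

end
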